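(* Let $1\le N<M$, let $H_0$ be a self-adjoint operator on $\mathcal{H}_N=\Lambda^N\mathbb{C}^M$, let $v\in\mathbb{R}^M$, and let $\Psi=\sum_I\Psi_Ie_I\in\mathcal{H}_N$ be an eigenstate of $H_0+V$. If the number of distinct multi-indices $I$ with $\Psi_I\ne0$ is strictly larger than $$g(M,N)=\begin{cases}\binom{M-1}{N}& \text{if } M>2N,\\[2pt] 2\binom{M-2}{N-1}& \text{if } M=2N,\\[2pt] \binom{M-1}{N-1}& \text{if } M<2N,\end{cases}$$ then $\Psi$ is not an eigenvector of any other Hamiltonian $H_0+V'$ with $v'\in\mathbb{R}^M$ such that $v'$ differs from $v$ by more than a constant (i.e. $v-v'$ is not a constant vector).
   Context: $X=\{1,\dots,M\}$ is the vertex set and $e_1,\dots,e_M$ the standard basis of $\mathbb{C}^M$. $\mathcal{H}_N=\Lambda^N\mathbb{C}^M$ has orthonormal basis $e_I=e_{i_1}\wedge\dots\wedge e_{i_N}$ indexed by ordered multi-indices $I=(i_1<\dots<i_N)$ in $X$. For $v\in\mathbb{R}^M$, the external potential operator $V$ on $\mathcal{H}_N$ is the diagonal operator $Ve_I=\big(\sum_{i\in I}v_i\big)e_I$, and $V'$ is defined from $v'$ in the same way. *)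

theory Defs
  imports
    Complex_Main
    "HOL-Library.Function_Algebras"
    "HOL-Combinatorics.Permutations"
    "HOL-Combinatorics.Multiset_Permutations"
begin

text \<open>
  The vertex set is \<open>X = {1..M}\<close>. The \<open>N\<close>-th tensor power of \<open>\<complex>\<^sup>M\<close> is the space of complex
  functions on \<open>X\<^sup>N\<close>, where a point of \<open>X\<^sup>N\<close> is a list; functions are required to
  vanish off \<open>X\<^sup>N\<close>, so that they are determined by their values there. The exterior power is
  realised as the subspace of antisymmetric tensors. Sums of tensors and of operators are the
  pointwise ones.
\<close>

type_synonym tensor = "nat list \<Rightarrow> complex"

definition configs :: "nat \<Rightarrow> nat \<Rightarrow> nat list set"
  where "configs M N = {xs. length xs = N \<and> set xs \<subseteq> {1..M}}"

definition exterior_power :: "nat \<Rightarrow> nat \<Rightarrow> tensor set"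
  where "exterior_power M N = {\<Psi>.
    (\<forall>xs. xs \<notin> configs M N \<longrightarrow> \<Psi> xs = 0) \<and>
    (\<forall>xs\<in>configs M N. \<forall>\<sigma>. \<sigma> permutes {..<N} \<longrightarrow>
       \<Psi> (permute_list \<sigma> xs) = of_int (sign \<sigma>) * \<Psi> xs)}"

definition scale :: "complex \<Rightarrow> tensor \<Rightarrow> tensor"
  where "scale c \<Psi> = (\<lambda>xs. c * \<Psi> xs)"

definition inner_product :: "nat \<Rightarrow> nat \<Rightarrow> tensor \<Rightarrow> tensor \<Rightarrow> complex"
  where "inner_product M N \<Phi> \<Psi> = (\<Sum>xs\<in>configs M N. cnj (\<Phi> xs) * \<Psi> xs)"

text \<open>
  The wedge product \<open>u\<^sub>1 \<and> \<dots> \<and> u\<^sub>N\<close>, with the normalisation \<open>1 / \<surd>N!\<close> under which wedges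
  of orthonormal vectors are normalised for the inner product of the tensor power.
\<close>

definition wedge :: "(nat \<Rightarrow> complex) list \<Rightarrow> tensor"
  where "wedge us = (\<lambda>xs. if length xs = length us
    then (\<Sum>\<sigma> | \<sigma> permutes {..<length us}.
            of_int (sign \<sigma>) * (\<Prod>k<length us. (us ! \<sigma> k) (xs ! k))) / of_real (sqrt (fact (length us)))
    else 0)"

definition std_basis :: "nat \<Rightarrow> nat \<Rightarrow> complex"
  where "std_basis i = (\<lambda>j. if j = i then 1 else 0)"

definition multi_indices :: "nat \<Rightarrow> nat \<Rightarrow> nat list set"
  where "multi_indices M N = {I. length I = N \<and> set I \<subseteq> {1..M} \<and> sorted_wrt (<) I}"

definition basis_wedge :: "nat list \<Rightarrow> tensor"
  where "basis_wedge I = wedge (map std_basis I)"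

text \<open>Only the values of \<open>v\<close> on \<open>{1..M}\<close> matter.\<close>

definition ext_potential :: "nat \<Rightarrow> nat \<Rightarrow> (nat \<Rightarrow> real) \<Rightarrow> tensor \<Rightarrow> tensor"
  where "ext_potential M N v \<Psi> =
    (\<Sum>I\<in>multi_indices M N.
       scale (of_real (\<Sum>i\<in>set I. v i) * inner_product M N (basis_wedge I) \<Psi>) (basis_wedge I))"

definition linear_operator :: "nat \<Rightarrow> nat \<Rightarrow> (tensor \<Rightarrow> tensor) \<Rightarrow> bool"
  where "linear_operator M N A \<longleftrightarrow>
    (\<forall>\<Psi>\<in>exterior_power M N. A \<Psi> \<in> exterior_power M N) \<and>
    (\<forall>\<Phi>\<in>exterior_power M N. \<forall>\<Psi>\<in>exterior_power M N. A (\<Phi> + \<Psi>) = A \<Phi> + A \<Psi>) \<and>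
    (\<forall>c. \<forall>\<Psi>\<in>exterior_power M N. A (scale c \<Psi>) = scale c (A \<Psi>))"

definition self_adjoint :: "nat \<Rightarrow> nat \<Rightarrow> (tensor \<Rightarrow> tensor) \<Rightarrow> bool"
  where "self_adjoint M N A \<longleftrightarrow>
    linear_operator M N A \<and>
    (\<forall>\<Phi>\<in>exterior_power M N. \<forall>\<Psi>\<in>exterior_power M N.
       inner_product M N \<Phi> (A \<Psi>) = inner_product M N (A \<Phi>) \<Psi>)"

definition eigenvector :: "nat \<Rightarrow> nat \<Rightarrow> (tensor \<Rightarrow> tensor) \<Rightarrow> tensor \<Rightarrow> bool"
  where "eigenvector M N A \<Psi> \<longleftrightarrow>
    \<Psi> \<in> exterior_power M N \<and> \<Psi> \<noteq> 0 \<and> (\<exists>E. A \<Psi> = scale E \<Psi>)"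

definition g :: "nat \<Rightarrow> nat \<Rightarrow> nat"
  where "g M N =
    (if M > 2 * N then (M - 1) choose N
     else if M = 2 * N then 2 * ((M - 2) choose (N - 1))
     else (M - 1) choose (N - 1))"


text \<open>
  The remaining facts confirm that the wedges \<open>e\<^sub>I\<close> form an orthonormal basis of the exterior
  power and that the potential is the diagonal operator determined by its values on them.
\<close>

lemma sum_tensor_apply: "(\<Sum>i\<in>A. (f i :: tensor)) xs = (\<Sum>i\<in>A. f i xs)"
  by (induction A rule: infinite_finite_induct) auto

lemma finite_configs [simp]: "finite (configs M N)"
proof -
  have "configs M N = {xs. set xs \<subseteq> {1..M} \<and> length xs = N}"
    by (auto simp: configs_def)
  then show ?thesis
    using finite_lists_length_eq[of "{1..M}" N] by simp
qed

lemma multi_indices_subset: "multi_indices M N \<subseteq> configs M N"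
  by (auto simp: multi_indices_def configs_def)

lemma finite_multi_indices [simp]: "finite (multi_indices M N)"
  using multi_indices_subset finite_configs by (rule finite_subset)

lemma multi_indices_distinct: "I \<in> multi_indices M N \<Longrightarrow> distinct I"
  by (auto simp: multi_indices_def strict_sorted_iff)

lemma multi_indices_eqI:
  "I \<in> multi_indices M N \<Longrightarrow> J \<in> multi_indices M N \<Longrightarrow> set I = set J \<Longrightarrow> I = J"
  by (auto simp: multi_indices_def strict_sorted_equal)

lemma permute_list_config:
  assumes "xs \<in> configs M N" "\<sigma> permutes {..<N}"
  shows "permute_list \<sigma> xs \<in> configs M N"
  using assms by (auto simp: configs_def)

lemma wedge_permute:
  assumes len: "length xs = length us" and \<tau>: "\<tau> permutes {..<length us}"
  shows "wedge us (permute_list \<tau> xs) = of_int (sign \<tau>) * wedge us xs"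
proof -
  let ?n = "length us"
  let ?P = "{\<sigma>. \<sigma> permutes {..<?n}}"
  have perm: "permutation \<sigma>" if "\<sigma> permutes {..<?n}" for \<sigma>
    using that by (rule permutes_imp_permutation[rotated]) simp
  have "(\<Sum>\<sigma>\<in>?P. of_int (sign \<sigma>) * (\<Prod>k<?n. (us ! \<sigma> k) (permute_list \<tau> xs ! k)))
      = (\<Sum>\<sigma>\<in>?P. of_int (sign (\<sigma> \<circ> \<tau>)) * (\<Prod>k<?n. (us ! (\<sigma> \<circ> \<tau>) k) (permute_list \<tau> xs ! k)) :: complex)"
    by (rule sum_permutations_compose_right[OF \<tau>])
  also have "\<dots> = (\<Sum>\<sigma>\<in>?P. of_int (sign \<tau>) * (of_int (sign \<sigma>) * (\<Prod>k<?n. (us ! \<sigma> k) (xs ! k))))"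
  proof (rule sum.cong, rule refl)
    fix \<sigma> assume "\<sigma> \<in> ?P"
    then have \<sigma>: "\<sigma> permutes {..<?n}" by simp
    have "(\<Prod>k<?n. (us ! (\<sigma> \<circ> \<tau>) k) (permute_list \<tau> xs ! k))
        = (\<Prod>k<?n. ((\<lambda>k. (us ! \<sigma> k) (xs ! k)) \<circ> \<tau>) k)"
      using \<tau> len by (intro prod.cong) (auto simp: permute_list_nth)
    also have "\<dots> = (\<Prod>k<?n. (us ! \<sigma> k) (xs ! k))"
      using prod.permute[OF \<tau>, of "\<lambda>k. (us ! \<sigma> k) (xs ! k)"] by (simp add: comp_def)
    finally show "of_int (sign (\<sigma> \<circ> \<tau>)) * (\<Prod>k<?n. (us ! (\<sigma> \<circ> \<tau>) k) (permute_list \<tau> xs ! k))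
        = of_int (sign \<tau>) * (of_int (sign \<sigma>) * (\<Prod>k<?n. (us ! \<sigma> k) (xs ! k)))"
      using sign_compose[OF perm[OF \<sigma>] perm[OF \<tau>]] by simp
  qed
  also have "\<dots> = of_int (sign \<tau>) * (\<Sum>\<sigma>\<in>?P. of_int (sign \<sigma>) * (\<Prod>k<?n. (us ! \<sigma> k) (xs ! k)))"
    by (simp add: sum_distrib_left)
  finally show ?thesis
    by (simp add: wedge_def len)
qed

lemma basis_wedge_self:
  assumes "distinct I"
  shows "basis_wedge I I = 1 / of_real (sqrt (fact (length I)))"
proof -
  let ?n = "length I"
  let ?P = "{\<sigma>. \<sigma> permutes {..<?n}}"
  have zero: "(\<Prod>k<?n. std_basis (I ! \<sigma> k) (I ! k)) = 0" if \<sigma>: "\<sigma> permutes {..<?n}" "\<sigma> \<noteq> id" for \<sigma>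
  proof -
    obtain k where k: "\<sigma> k \<noteq> k"
      using \<sigma>(2) by (metis eq_id_iff)
    then have "k < ?n"
      using permutes_not_in[OF \<sigma>(1), of k] by auto
    moreover from this have "\<sigma> k < ?n"
      using permutes_in_image[OF \<sigma>(1), of k] by simp
    ultimately have "std_basis (I ! \<sigma> k) (I ! k) = 0"
      using assms k by (simp add: std_basis_def nth_eq_iff_index_eq)
    then show ?thesis using \<open>k < ?n\<close> by (meson finite_lessThan lessThan_iff prod_zero)
  qed
  have idx: "(\<Prod>k<?n. (map std_basis I ! \<sigma> k) (I ! k)) = (\<Prod>k<?n. std_basis (I ! \<sigma> k) (I ! k))"
    if "\<sigma> permutes {..<?n}" for \<sigma>
    using permutes_in_image[OF that] by (intro prod.cong) auto
  have "(\<Sum>\<sigma>\<in>?P. of_int (sign \<sigma>) * (\<Prod>k<?n. (map std_basis I ! \<sigma> k) (I ! k)))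
      = (\<Sum>\<sigma>\<in>?P. if \<sigma> = id then 1 else 0 :: complex)"
    by (rule sum.cong) (auto simp: idx zero, auto simp: std_basis_def)
  also have "\<dots> = 1"
    by (simp add: finite_permutations permutes_id)
  finally show ?thesis
    by (simp add: basis_wedge_def wedge_def)
qed

lemma basis_wedge_nonzero:
  assumes "basis_wedge I xs \<noteq> 0"
  obtains \<tau> where "\<tau> permutes {..<length I}" "xs = permute_list \<tau> I"
proof -
  let ?n = "length I"
  have len: "length xs = ?n"
    using assms by (auto simp: basis_wedge_def wedge_def split: if_splits)
  have "(\<Sum>\<sigma> | \<sigma> permutes {..<?n}. of_int (sign \<sigma>) * (\<Prod>k<?n. (map std_basis I ! \<sigma> k) (xs ! k))) \<noteq> (0::complex)"
    using assms len by (auto simp: basis_wedge_def wedge_def)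
  then obtain \<sigma> where \<sigma>: "\<sigma> permutes {..<?n}"
      and nz: "of_int (sign \<sigma>) * (\<Prod>k<?n. (map std_basis I ! \<sigma> k) (xs ! k)) \<noteq> (0::complex)"
    by (auto elim: sum.not_neutral_contains_not_neutral)
  have "xs ! k = I ! \<sigma> k" if "k < ?n" for k
  proof -
    have "(map std_basis I ! \<sigma> k) (xs ! k) \<noteq> 0"
      using nz that by auto
    moreover have "\<sigma> k < ?n"
      using permutes_in_image[OF \<sigma>, of k] that by simp
    ultimately show ?thesis
      by (auto simp: std_basis_def split: if_splits)
  qed
  then have "xs = permute_list \<sigma> I"
    using len \<sigma> by (intro nth_equalityI) (auto simp: permute_list_nth)
  with \<sigma> show ?thesis by (rule that)
qed

lemma basis_wedge_permute:
  assumes "distinct I" "\<tau> permutes {..<length I}"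
  shows "basis_wedge I (permute_list \<tau> I) = of_int (sign \<tau>) / of_real (sqrt (fact (length I)))"
  using wedge_permute[of I "map std_basis I" \<tau>] basis_wedge_self[OF assms(1)] assms
  by (simp add: basis_wedge_def)

lemma basis_wedge_in_exterior_power:
  assumes "I \<in> multi_indices M N"
  shows "basis_wedge I \<in> exterior_power M N"
proof -
  have I: "length I = N" "I \<in> configs M N"
    using assms multi_indices_subset by (auto simp: multi_indices_def)
  have "basis_wedge I xs = 0" if "xs \<notin> configs M N" for xs
    using that I by (metis basis_wedge_nonzero permute_list_config)
  moreover have "basis_wedge I (permute_list \<sigma> xs) = of_int (sign \<sigma>) * basis_wedge I xs"
    if "xs \<in> configs M N" "\<sigma> permutes {..<N}" for xs \<sigma>
    using that I by (simp add: basis_wedge_def wedge_permute configs_def)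
  ultimately show ?thesis
    by (auto simp: exterior_power_def)
qed

lemma basis_wedge_inner_product:
  assumes I: "I \<in> multi_indices M N" and \<Psi>: "\<Psi> \<in> exterior_power M N"
  shows "inner_product M N (basis_wedge I) \<Psi> = of_real (sqrt (fact N)) * \<Psi> I"
proof -
  have len: "length I = N" and Ic: "I \<in> configs M N" and dist: "distinct I"
    using I multi_indices_subset multi_indices_distinct by (auto simp: multi_indices_def)
  have sub: "permutations_of_set (set I) \<subseteq> configs M N"
    using Ic dist by (auto simp: configs_def permutations_of_set_def distinct_card[symmetric])
  have "inner_product M N (basis_wedge I) \<Psi>
      = (\<Sum>xs\<in>permutations_of_set (set I). cnj (basis_wedge I xs) * \<Psi> xs)"
    unfolding inner_product_def
  proof (rule sum.mono_neutral_right[OF finite_configs sub], safe)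
    fix xs assume "xs \<notin> permutations_of_set (set I)"
    then have "basis_wedge I xs = 0"
      using dist by (metis basis_wedge_nonzero permutations_of_setI set_permute_list distinct_permute_list)
    then show "cnj (basis_wedge I xs) * \<Psi> xs = 0" by simp
  qed
  also have "\<dots> = (\<Sum>xs\<in>permutations_of_set (set I). \<Psi> I / of_real (sqrt (fact N)))"
  proof (rule sum.cong, rule refl)
    fix xs assume "xs \<in> permutations_of_set (set I)"
    then have "mset xs = mset I"
      using dist by (auto simp: permutations_of_set_def set_eq_iff_mset_eq_distinct)
    then obtain \<tau> where \<tau>: "\<tau> permutes {..<length I}" "permute_list \<tau> I = xs"
      by (rule mset_eq_permutation)
    have "\<Psi> xs = of_int (sign \<tau>) * \<Psi> I"
      using \<Psi> Ic \<tau> len by (auto simp: exterior_power_def)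
    moreover have "of_int (sign \<tau>) * of_int (sign \<tau>) = (1::complex)"
      by (metis of_int_1 of_int_mult sign_idempotent)
    ultimately show "cnj (basis_wedge I xs) * \<Psi> xs = \<Psi> I / of_real (sqrt (fact N))"
      using basis_wedge_permute[OF dist \<tau>(1)] \<tau>(2) len by (simp add: mult.assoc[symmetric])
  qed
  also have "\<dots> = fact N * (\<Psi> I / of_real (sqrt (fact N)))"
    using dist len by (simp add: distinct_card)
  also have "\<dots> = of_real (sqrt (fact N)) * \<Psi> I"
  proof -
    have "complex_of_real (sqrt (fact N)) * of_real (sqrt (fact N)) = fact N"
      by (simp flip: of_real_mult)
    moreover have "complex_of_real (sqrt (fact N)) \<noteq> 0" by simp
    ultimately show ?thesis by (simp add: field_simps)
  qed
  finally show ?thesis .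
qed

lemma basis_wedge_orthonormal:
  assumes "I \<in> multi_indices M N" "J \<in> multi_indices M N"
  shows "inner_product M N (basis_wedge I) (basis_wedge J) = (if I = J then 1 else 0)"
proof -
  have "basis_wedge J I = 0" if "I \<noteq> J"
    using that assms by (metis basis_wedge_nonzero multi_indices_eqI set_permute_list)
  moreover have "basis_wedge J J = 1 / of_real (sqrt (fact N))"
    using assms basis_wedge_self[OF multi_indices_distinct[OF assms(2)]]
    by (simp add: multi_indices_def)
  ultimately show ?thesis
    by (simp add: basis_wedge_inner_product basis_wedge_in_exterior_power assms)
qed

lemma exterior_power_repeated:
  assumes \<Psi>: "\<Psi> \<in> exterior_power M N" and nd: "\<not> distinct xs"
  shows "\<Psi> xs = 0"
proof (cases "xs \<in> configs M N")
  case True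
  then have len: "length xs = N" by (simp add: configs_def)
  obtain i j where ij: "i < N" "j < N" "i \<noteq> j" "xs ! i = xs ! j"
    using nd len by (auto simp: distinct_conv_nth)
  have t: "transpose i j permutes {..<N}"
    using ij by (intro permutes_swap_id) auto
  have "permute_list (transpose i j) xs = xs"
    using ij t len
    by (intro nth_equalityI) (auto simp: permute_list_nth transpose_def)
  then have "\<Psi> xs = - \<Psi> xs"
    using \<Psi> True t ij(3) by (force simp: exterior_power_def sign_swap_id)
  then show ?thesis by simp
next
  case False
  then show ?thesis using \<Psi> by (simp add: exterior_power_def)
qed

lemma exterior_power_expansion:
  assumes \<Psi>: "\<Psi> \<in> exterior_power M N"
  shows "\<Psi> = (\<Sum>I\<in>multi_indices M N. scale (inner_product M N (basis_wedge I) \<Psi>) (basis_wedge I))"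
proof
  fix xs
  let ?R = "\<Sum>I\<in>multi_indices M N. inner_product M N (basis_wedge I) \<Psi> * basis_wedge I xs"
  have "\<Psi> xs = ?R"
  proof (cases "xs \<in> configs M N \<and> distinct xs")
    case True
    define J where "J = sort xs"
    have J: "J \<in> multi_indices M N"
      using True by (auto simp: J_def multi_indices_def configs_def strict_sorted_iff)
    have "mset xs = mset J" by (simp add: J_def)
    then obtain \<tau> where \<tau>: "\<tau> permutes {..<length J}" "permute_list \<tau> J = xs"
      by (rule mset_eq_permutation)
    have len: "length J = N" using J by (simp add: multi_indices_def)
    have "?R = (\<Sum>I\<in>multi_indices M N. if I = J then inner_product M N (basis_wedge J) \<Psi> * basis_wedge J xs else 0)"
    proof (rule sum.cong, rule refl)
      fix I assume I: "I \<in> multi_indices M N"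
      have "basis_wedge I xs = 0" if "I \<noteq> J"
        using that I J \<tau> by (metis basis_wedge_nonzero multi_indices_eqI set_permute_list)
      then show "inner_product M N (basis_wedge I) \<Psi> * basis_wedge I xs
          = (if I = J then inner_product M N (basis_wedge J) \<Psi> * basis_wedge J xs else 0)"
        by simp
    qed
    also have "\<dots> = inner_product M N (basis_wedge J) \<Psi> * basis_wedge J xs"
      using J by simp
    also have "\<dots> = of_int (sign \<tau>) * \<Psi> J"
      using basis_wedge_permute[OF multi_indices_distinct[OF J] \<tau>(1)] \<tau>(2) len
      by (simp add: basis_wedge_inner_product[OF J \<Psi>])
    also have "\<dots> = \<Psi> xs"
      using \<Psi> subsetD[OF multi_indices_subset J] \<tau> len by (auto simp: exterior_power_def)
    finally show ?thesis by simp
  next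
    case False
    have zero: "\<Phi> xs = 0" if "\<Phi> \<in> exterior_power M N" for \<Phi>
      using False exterior_power_repeated[OF that, of xs] that by (auto simp: exterior_power_def)
    show ?thesis
      by (simp add: zero \<Psi> basis_wedge_in_exterior_power)
  qed
  then show "\<Psi> xs = (\<Sum>I\<in>multi_indices M N. scale (inner_product M N (basis_wedge I) \<Psi>) (basis_wedge I)) xs"
    by (simp add: sum_tensor_apply scale_def)
qed

lemma ext_potential_basis_wedge:
  assumes "I \<in> multi_indices M N"
  shows "ext_potential M N v (basis_wedge I) = scale (of_real (\<Sum>i\<in>set I. v i)) (basis_wedge I)"
proof
  fix xs
  have "ext_potential M N v (basis_wedge I) xs
      = (\<Sum>J\<in>multi_indices M N. if J = I then of_real (\<Sum>i\<in>set I. v i) * basis_wedge I xs else 0)"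
    unfolding ext_potential_def sum_tensor_apply scale_def
    by (rule sum.cong) (auto simp: basis_wedge_orthonormal assms)
  then show "ext_potential M N v (basis_wedge I) xs
      = scale (of_real (\<Sum>i\<in>set I. v i)) (basis_wedge I) xs"
    using assms by (simp add: scale_def)
qed

lemma exterior_power_scale:
  "\<Psi> \<in> exterior_power M N \<Longrightarrow> scale c \<Psi> \<in> exterior_power M N"
  by (auto simp: exterior_power_def scale_def)

lemma exterior_power_sum:
  assumes "\<And>i. i \<in> A \<Longrightarrow> f i \<in> exterior_power M N"
  shows "(\<Sum>i\<in>A. f i) \<in> exterior_power M N"
  using assms
  by (induction A rule: infinite_finite_induct) (auto simp: exterior_power_def distrib_left)

lemma linear_operator_ext_potential: "linear_operator M N (ext_potential M N v)"
  unfolding linear_operator_def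
proof (intro conjI ballI allI)
  fix \<Psi>
  show "ext_potential M N v \<Psi> \<in> exterior_power M N"
    unfolding ext_potential_def
    by (intro exterior_power_sum exterior_power_scale basis_wedge_in_exterior_power)
next
  fix \<Phi> \<Psi>
  show "ext_potential M N v (\<Phi> + \<Psi>) = ext_potential M N v \<Phi> + ext_potential M N v \<Psi>"
    by (simp add: fun_eq_iff ext_potential_def inner_product_def sum_tensor_apply scale_def
        distrib_left distrib_right sum.distrib)
next
  fix c \<Psi>
  show "ext_potential M N v (scale c \<Psi>) = scale c (ext_potential M N v \<Psi>)"
    by (simp add: fun_eq_iff ext_potential_def inner_product_def sum_tensor_apply scale_def
        sum_distrib_left mult_ac)
qed

end

theory Submission
  imports Defs
begin

text \<open>
  Subtracting the two eigenvalue equations shows that \<open>w = v - v'\<close> has the same sum over every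
  multi-index in the support of \<open>\<Psi>\<close>, so it suffices to bound the number of \<open>N\<close>-subsets of an
  \<open>M\<close>-set on which a non-constant weight \<open>w\<close> has a prescribed sum. Removing an element that leaves
  \<open>w\<close> non-constant reproduces Pascal's recursion for \<^term>\<open>g\<close>, except when \<open>M = 2 * N \<plusminus> 1\<close>. For
  \<open>M = 2 * N + 1\<close> one removes two elements \<open>x, y\<close> with \<open>w x \<noteq> w y\<close> instead: the sets containing
  only \<open>x\<close> and those containing only \<open>y\<close> have disjoint traces on the remaining elements. The case
  \<open>M = 2 * N - 1\<close> follows by complementation.
\<close>

section \<open>Subsets of prescribed size and weight\<close>

definition weight_level :: "'a set \<Rightarrow> ('a \<Rightarrow> 'b::ring_1) \<Rightarrow> nat \<Rightarrow> 'b \<Rightarrow> 'a set set"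
  where "weight_level X w N E = {I. I \<subseteq> X \<and> card I = N \<and> sum w I = E}"

lemma finite_weight_level: "finite X \<Longrightarrow> finite (weight_level X w N E)"
  by (simp add: weight_level_def)

lemma card_weight_level_le_choose:
  assumes "finite X"
  shows "card (weight_level X w N E) \<le> card X choose N"
proof -
  have "card (weight_level X w N E) \<le> card {I. I \<subseteq> X \<and> card I = N}"
    using assms by (intro card_mono) (auto simp: weight_level_def)
  then show ?thesis using n_subsets[OF assms] by simp
qed

lemma card_weight_level_insert:
  assumes "finite Y" "x \<notin> Y"
  shows "card (weight_level (insert x Y) w (Suc N) E)
    = card (weight_level Y w N (E - w x)) + card (weight_level Y w (Suc N) E)"
proof -
  let ?A = "insert x ` weight_level Y w N (E - w x)" and ?B = "weight_level Y w (Suc N) E"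
  have fin: "finite I" if "I \<subseteq> Y" for I
    using that assms(1) finite_subset by blast
  have eq: "weight_level (insert x Y) w (Suc N) E = ?A \<union> ?B"
  proof (intro equalityI subsetI)
    fix I assume I: "I \<in> weight_level (insert x Y) w (Suc N) E"
    show "I \<in> ?A \<union> ?B"
    proof (cases "x \<in> I")
      case True
      have "finite I" using I assms(1) by (auto simp: weight_level_def intro: finite_subset)
      then have "I - {x} \<in> weight_level Y w N (E - w x)"
        using I True by (auto simp: weight_level_def sum_diff1)
      moreover have "I = insert x (I - {x})" using True by auto
      ultimately show ?thesis by blast
    next
      case False
      then show ?thesis using I by (auto simp: weight_level_def)
    qed
  next
    fix I assume "I \<in> ?A \<union> ?B"
    then show "I \<in> weight_level (insert x Y) w (Suc N) E"
    proof
      assume "I \<in> ?A"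
      then obtain J where J: "J \<in> weight_level Y w N (E - w x)" "I = insert x J" by blast
      moreover have "x \<notin> J" "finite J"
        using J assms fin by (auto simp: weight_level_def)
      ultimately show ?thesis by (auto simp: weight_level_def)
    qed (auto simp: weight_level_def)
  qed
  have "inj_on (insert x) (weight_level Y w N (E - w x))"
    using assms(2) by (intro inj_onI) (auto simp: weight_level_def insert_ident)
  moreover have "?A \<inter> ?B = {}" using assms(2) by (auto simp: weight_level_def)
  ultimately show ?thesis
    by (simp add: eq card_Un_disjoint finite_weight_level assms(1) card_image)
qed

lemma card_weight_level_complement:
  assumes X: "finite X" and N: "N \<le> card X"
  shows "card (weight_level X w N E) \<le> card (weight_level X w (card X - N) (sum w X - E))"
proof (rule card_inj_on_le)
  show "inj_on ((-) X) (weight_level X w N E)"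
    by (intro inj_onI) (auto simp: weight_level_def)
  show "(-) X ` weight_level X w N E \<subseteq> weight_level X w (card X - N) (sum w X - E)"
    using X by (auto simp: weight_level_def card_Diff_subset finite_subset sum_diff)
qed (simp add: finite_weight_level X)

text \<open>A set avoiding \<open>x\<close> can reach the sum \<open>E\<close> only if
  \<open>E\<close> is \<open>Suc N\<close> times \<open>t\<close>, and a set containing
  \<open>x\<close> would then force \<open>w x = t\<close>. So one of the two families obtained by
  splitting at \<open>x\<close> is empty, and a maximum replaces the sum.\<close>

lemma card_weight_level_star:
  assumes Y: "finite Y" "x \<notin> Y" and t: "\<forall>y\<in>Y. w y = t" "w x \<noteq> t"
  shows "card (weight_level (insert x Y) w (Suc N) E) \<le> max (card Y choose N) (card Y choose Suc N)"
proof (cases "weight_level Y w (Suc N) E = {}")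
  case True
  then show ?thesis
    using card_weight_level_le_choose[OF Y(1), of w N "E - w x"]
    by (simp add: card_weight_level_insert[OF Y])
next
  case False
  then have "E = of_nat (Suc N) * t"
    using t(1) by (force simp: weight_level_def subset_iff)
  then have "weight_level Y w N (E - w x) = {}"
    using t by (force simp: weight_level_def subset_iff algebra_simps)
  then show ?thesis
    using card_weight_level_le_choose[OF Y(1), of w "Suc N" E]
    by (simp add: card_weight_level_insert[OF Y])
qed

lemma card_weight_level_disjoint:
  assumes "finite Y" "E \<noteq> F"
  shows "card (weight_level Y w N E) + card (weight_level Y w N F) \<le> card Y choose N"
proof -
  have "card (weight_level Y w N E) + card (weight_level Y w N F)
      = card (weight_level Y w N E \<union> weight_level Y w N F)"
    using assms by (intro card_Un_disjoint[symmetric]) (auto simp: weight_level_def)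
  also have "\<dots> \<le> card {I. I \<subseteq> Y \<and> card I = N}"
    using assms by (intro card_mono) (auto simp: weight_level_def)
  finally show ?thesis using n_subsets[OF assms(1)] by simp
qed

section \<open>Recursion and symmetry of the bound\<close>

text \<open>The excluded \<open>M\<close> are those with \<open>Suc M = 2 * Suc N + 1\<close> or
  \<open>Suc M = 2 * Suc N - 1\<close>. At \<open>M = 2 * N + 1\<close> both summands equal
  \<open>(2 * N) choose N\<close>, whence the factor 2 in \<open>g\<close>; otherwise this is the
  ordinary Pascal rule.\<close>

lemma g_pascal:
  assumes "M \<noteq> 2 * N + 2" "M \<noteq> 2 * N" "M \<ge> 2"
  shows "g M N + g M (Suc N) = g (Suc M) (Suc N)"
proof -
  obtain m where m: "M = Suc (Suc m)"
    using assms(3) by (metis add_2_eq_Suc le_Suc_ex)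
  consider "M > 2 * N + 2" | "M = 2 * N + 1" | "M < 2 * N"
    using assms by linarith
  then show ?thesis
  proof cases
    case 3
    then obtain n where "N = Suc n" by (cases N) auto
    with 3 m show ?thesis by (auto simp: g_def)
  qed (use m in \<open>auto simp: g_def\<close>)
qed

lemma g_complement:
  assumes "N \<le> M" "0 < M"
  shows "g M (M - N) = g M N"
proof -
  consider "M > 2 * N" | "M = 2 * N" | "M < 2 * N" by linarith
  then show ?thesis
  proof cases
    case 1
    then show ?thesis using binomial_symmetric[of N "M - 1"] by (auto simp: g_def)
  next
    case 2
    then show ?thesis by (auto simp: g_def)
  next
    case 3
    then have "M - 1 - (N - 1) = M - N" "N - 1 \<le> M - 1" "M > 2 * (M - N)" using assms by auto
    then show ?thesis using 3 binomial_symmetric[of "N - 1" "M - 1"] by (auto simp: g_def)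
  qed
qed

section \<open>The bound for non-constant weights\<close>

text \<open>In the first case \<open>x\<close> and \<open>y\<close> can be deleted while
  \<open>c\<close> and \<open>d\<close> keep the weight non-constant. The only obstruction is a
  weight with a single exceptional point.\<close>

lemma nonconstant_pair_cases:
  assumes X: "finite X" "card X \<ge> 4" and ab: "a \<in> X" "b \<in> X" "w a \<noteq> w b"
  obtains (disjoint) x y c d where "x \<in> X" "y \<in> X" "w x \<noteq> w y"
      "c \<in> X - {x, y}" "d \<in> X - {x, y}" "w c \<noteq> w d"
    | (star) x t where "x \<in> X" "w x \<noteq> t" "\<forall>y\<in>X - {x}. w y = t"
proof (cases "\<exists>c\<in>X - {a, b}. \<exists>d\<in>X - {a, b}. w c \<noteq> w d")
  case True
  then show ?thesis using disjoint ab by blast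
next
  case False
  have "card (X - {a, b}) \<ge> 2"
    using X ab diff_card_le_card_Diff[of "{a, b}" X] by (auto simp: card_insert_if split: if_splits)
  then obtain c d where cd: "c \<in> X - {a, b}" "d \<in> X - {a, b}" "c \<noteq> d"
    by (metis card_le_Suc0_iff_eq X(1) finite_Diff not_less_eq_eq numeral_2_eq_2)
  have const: "\<forall>y\<in>X - {a, b}. w y = w c" using False cd by blast
  consider "w a \<noteq> w c" "w b \<noteq> w c" | "w a = w c" | "w b = w c" by blast
  then show ?thesis
  proof cases
    \<comment> \<open>Both \<open>a\<close> and \<open>b\<close> differ from the common value of the
      other points, so they are paired with distinct points \<open>c\<close> and
      \<open>d\<close>.\<close>
    case 1
    then have "w b \<noteq> w d" using const cd by metis
    then show ?thesis using 1 ab cd by (intro disjoint[of a c b d]) auto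
  next
    case 2
    then show ?thesis using ab const by (intro star[of b "w c"]) auto
  next
    case 3
    then show ?thesis using ab const by (intro star[of a "w c"]) auto
  qed
qed

theorem card_weight_level_le_g:
  fixes w :: "'a \<Rightarrow> 'b::ring_1"
  assumes "finite X" and "a \<in> X" "b \<in> X" "w a \<noteq> w b"
  shows "card (weight_level X w N E) \<le> g (card X) N"
  using assms
proof (induction "card X" arbitrary: X N E a b rule: less_induct)
  case less
  note X = less.prems(1) and ab = less.prems(2-4)
  have choose: "card (weight_level X w K F) \<le> card X choose K" for K F
    by (rule card_weight_level_le_choose[OF X])
  have card2: "card X \<ge> 2"
    using card_mono[OF X, of "{a, b}"] ab by (auto simp: card_insert_if split: if_splits)
  \<comment> \<open>\<open>K\<close> and \<open>F\<close> are arbitrary because this is applied to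
    the same set \<open>X\<close> both at size \<open>N\<close> and at the complementary
    size.\<close>
  have main: "card (weight_level X w K F) \<le> g (card X) K" if K: "card X \<noteq> 2 * K - 1" for K F
  proof -
    consider "K = 0" | "card X = 2" "K \<noteq> 0" | "card X = 3" "K = 1"
      | n where "card X = 2 * n + 5" "K = Suc (Suc n)"
      | n where "card X \<ge> 3" "K = Suc n" "card X \<noteq> 2 * n + 3" "card X \<noteq> 2 * n + 1"
    proof (cases K)
      case 0
      then show ?thesis using that(1) by simp
    next
      case (Suc n)
      show ?thesis
      proof (cases "card X = 2 * n + 3")
        case True
        then show ?thesis using that(3,4) Suc by (cases n) auto
      next
        case False
        then show ?thesis using that(2,5) Suc K card2 by force
      qed
    qed
    then show ?thesis
    proof cases
      case 1
      then show ?thesis using choose[of K F] card2 by (simp add: g_def)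
    next
      case 2
      then consider "K = 1" | "K = 2" | "K > 2" by linarith
      then show ?thesis using choose[of K F] 2(1) by cases (auto simp: g_def binomial_eq_0)
    next
      case 3
      \<comment> \<open>The weight cannot equal \<open>F\<close> at both \<open>a\<close> and
        \<open>b\<close>, so at most two of the three singletons count, and
        \<open>g 3 1 = 2\<close>.\<close>
      obtain z where "z \<in> X" "w z \<noteq> F" using ab by metis
      then have "{z} \<in> {I. I \<subseteq> X \<and> card I = K} - weight_level X w K F"
        using 3 by (simp add: weight_level_def)
      moreover have "weight_level X w K F \<subseteq> {I. I \<subseteq> X \<and> card I = K}"
        by (auto simp: weight_level_def)
      ultimately have "weight_level X w K F \<subset> {I. I \<subseteq> X \<and> card I = K}"
        by blast
      then have "card (weight_level X w K F) < card {I. I \<subseteq> X \<and> card I = K}"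
        using X by (intro psubset_card_mono) auto
      then show ?thesis using n_subsets[OF X, of K] 3 by (simp add: g_def)
    next
      case (4 n)
      have "card X \<ge> 4" using 4 by simp
      from X this ab show ?thesis
      proof (cases rule: nonconstant_pair_cases[where w = w])
        case (disjoint x y c d)
        define Y where "Y = X - {x, y}"
        have Y: "finite Y" "x \<notin> insert y Y" "y \<notin> Y" "X = insert x (insert y Y)"
          using X disjoint by (auto simp: Y_def)
        then have cY: "card Y = 2 * n + 3" using 4 by simp
        have IH: "card (weight_level Y w k e) \<le> g (2 * n + 3) k" for k e
          using less.hyps[of Y c d k e] disjoint(4-6) Y(1) cY 4(1) by (simp add: Y_def)
        \<comment> \<open>The sets are split by their trace on \<open>{x, y}\<close>. The two middle
          families have different target sums, so together they cost only one binomial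
          coefficient.\<close>
        have "card (weight_level X w K F)
            = card (weight_level Y w n (F - w x - w y))
            + (card (weight_level Y w (Suc n) (F - w x)) + card (weight_level Y w (Suc n) (F - w y)))
            + card (weight_level Y w (Suc (Suc n)) F)"
          unfolding 4(2) Y(4) using Y by (simp add: card_weight_level_insert)
        also have "\<dots> \<le> g (2 * n + 3) n + ((2 * n + 3) choose Suc n) + g (2 * n + 3) (Suc (Suc n))"
          using IH[of n "F - w x - w y"] IH[of "Suc (Suc n)" F] cY disjoint(3)
            card_weight_level_disjoint[OF Y(1), of "F - w x" "F - w y" w "Suc n"]
          by simp
        \<comment> \<open>The outer terms are \<open>(2 * n + 2) choose n\<close> and
          \<open>(2 * n + 2) choose (n + 1)\<close>; they add up to the middle term, which is
          symmetric to \<open>(2 * n + 3) choose (n + 2)\<close>.\<close>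
        also have "\<dots> = (2 * n + 4) choose (n + 2)"
        proof -
          have "(2 * n + 3) choose Suc n = (2 * n + 3) choose (n + 2)"
            using binomial_symmetric[of "Suc n" "2 * n + 3"] by simp
          then show ?thesis by (simp add: g_def eval_nat_numeral)
        qed
        also have "\<dots> = g (card X) K" using 4 by (simp add: g_def add.commute)
        finally show ?thesis .
      next
        case (star x t)
        define Y where "Y = X - {x}"
        have Y: "finite Y" "x \<notin> Y" "X = insert x Y" using X star by (auto simp: Y_def)
        then have cY: "card Y = 2 * n + 4" using 4 by simp
        have "card (weight_level X w K F) \<le> max (card Y choose Suc n) (card Y choose Suc (Suc n))"
          unfolding 4(2) Y(3) using star Y(1,2)
          by (intro card_weight_level_star[of _ _ _ t]) (auto simp: Y_def)
        \<comment> \<open>The size of \<open>Y\<close> is even and \<open>n + 2\<close> is its half,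
          so the central coefficient is the larger one.\<close>
        also have "\<dots> = (2 * n + 4) choose (n + 2)"
          using binomial_maximum[of "2 * n + 4" "Suc n"] cY by (simp add: max_def)
        also have "\<dots> = g (card X) K" using 4 by (simp add: g_def add.commute)
        finally show ?thesis .
      qed
    next
      case (5 n)
      have "card (X - {a, b}) \<ge> 1"
        using diff_card_le_card_Diff[of "{a, b}" X] 5(1) ab by (auto simp: card_insert_if split: if_splits)
      \<comment> \<open>As \<open>x\<close> is neither \<open>a\<close> nor \<open>b\<close>, the
        weight stays non-constant on \<open>Y\<close>.\<close>
      then obtain x where x: "x \<in> X - {a, b}" by (metis card.empty ex_in_conv not_one_le_zero)
      define Y where "Y = X - {x}"
      have Y: "finite Y" "x \<notin> Y" "X = insert x Y" using X x by (auto simp: Y_def)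
      then have cX: "card X = Suc (card Y)" by simp
      have IH: "card (weight_level Y w k e) \<le> g (card Y) k" for k e
        using less.hyps[of Y a b k e] x ab Y(1) cX by (auto simp: Y_def)
      have "card (weight_level X w K F) \<le> g (card Y) n + g (card Y) (Suc n)"
        using IH[of n "F - w x"] IH[of "Suc n" F] 5(2) Y
        by (simp add: card_weight_level_insert add_mono)
      also have "\<dots> = g (card X) K"
        using g_pascal[of "card Y" n] 5 cX by auto
      finally show ?thesis .
    qed
  qed
  show ?case
  proof (cases "card X = 2 * N - 1")
    case True
    \<comment> \<open>The complementary size is \<open>N - 1\<close>, and
      \<open>card X = 2 * (N - 1) + 1\<close> falls under \<open>main\<close>.\<close>
    with card2 have N: "N \<le> card X" "card X \<noteq> 2 * (card X - N) - 1" by auto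
    have "card (weight_level X w N E) \<le> card (weight_level X w (card X - N) (sum w X - E))"
      by (rule card_weight_level_complement[OF X N(1)])
    also have "\<dots> \<le> g (card X) (card X - N)" by (rule main[OF N(2)])
    also have "\<dots> = g (card X) N" using N(1) card2 by (intro g_complement) auto
    finally show ?thesis .
  qed (rule main)
qed

section \<open>From eigenvectors to weights\<close>

text \<open>A basis wedge is supported on the rearrangements of its multi-index, so evaluation at an
  increasing list isolates one coefficient, up to the normalisation of the wedge.\<close>

lemma basis_wedge_expansion_nth:
  assumes "I \<in> multi_indices M N"
  shows "(\<Sum>J\<in>multi_indices M N. scale (c J) (basis_wedge J)) I = c I / of_real (sqrt (fact N))"
proof -
  have "basis_wedge J I = 0" if "J \<in> multi_indices M N" "J \<noteq> I" for J
    using that assms by (metis basis_wedge_nonzero multi_indices_eqI set_permute_list)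
  then have "(\<Sum>J\<in>multi_indices M N. scale (c J) (basis_wedge J)) I
      = (\<Sum>J\<in>multi_indices M N. if J = I then c I * basis_wedge I I else 0)"
    unfolding sum_tensor_apply scale_def by (intro sum.cong) auto
  then show ?thesis
    using assms basis_wedge_self[OF multi_indices_distinct[OF assms]] multi_indices_subset[of M N]
    by (auto simp: configs_def)
qed

lemma ext_potential_nth:
  assumes "I \<in> multi_indices M N" "\<Psi> \<in> exterior_power M N"
  shows "ext_potential M N v \<Psi> I = of_real (\<Sum>i\<in>set I. v i) * \<Psi> I"
  using assms unfolding ext_potential_def
  by (simp add: basis_wedge_expansion_nth basis_wedge_inner_product)

theorem corollary10:
  fixes M N :: nat and H0 :: "tensor \<Rightarrow> tensor" and v :: "nat \<Rightarrow> real"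
    and \<Psi> :: tensor and c :: "nat list \<Rightarrow> complex"
  assumes "1 \<le> N" and "N < M"
    and "self_adjoint M N H0"
    and "\<Psi> = (\<Sum>I\<in>multi_indices M N. scale (c I) (basis_wedge I))"
    and "eigenvector M N (H0 + ext_potential M N v) \<Psi>"
    and "card {I \<in> multi_indices M N. c I \<noteq> 0} > g M N"
  shows "\<forall>v' :: nat \<Rightarrow> real. \<not> (\<exists>a. \<forall>i\<in>{1..M}. v i - v' i = a) \<longrightarrow>
    \<not> eigenvector M N (H0 + ext_potential M N v') \<Psi>"
proof (intro allI impI notI)
  fix v' :: "nat \<Rightarrow> real"
  assume nc: "\<not> (\<exists>a. \<forall>i\<in>{1..M}. v i - v' i = a)"
    and ev': "eigenvector M N (H0 + ext_potential M N v') \<Psi>"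
  \<comment> \<open>The eigenvalues are a priori only complex, so the weight is taken complex as
    well.\<close>
  define w where "w i = complex_of_real (v i - v' i)" for i
  obtain E E' where E: "(H0 + ext_potential M N v) \<Psi> = scale E \<Psi>"
      and E': "(H0 + ext_potential M N v') \<Psi> = scale E' \<Psi>"
      and ext: "\<Psi> \<in> exterior_power M N"
    using assms(5) ev' by (auto simp: eigenvector_def)
  have "set ` {I \<in> multi_indices M N. c I \<noteq> 0} \<subseteq> weight_level {1..M} w N (E - E')"
  proof (rule image_subsetI)
    fix I assume "I \<in> {I \<in> multi_indices M N. c I \<noteq> 0}"
    then have I: "I \<in> multi_indices M N" and "c I \<noteq> 0" by auto
    then have nz: "\<Psi> I \<noteq> 0"
      by (simp add: assms(4) basis_wedge_expansion_nth)
    have "H0 \<Psi> I + of_real (\<Sum>i\<in>set I. v i) * \<Psi> I = E * \<Psi> I"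
      using fun_cong[OF E, of I] ext_potential_nth[OF I ext, of v] by (simp add: scale_def)
    moreover have "H0 \<Psi> I + of_real (\<Sum>i\<in>set I. v' i) * \<Psi> I = E' * \<Psi> I"
      using fun_cong[OF E', of I] ext_potential_nth[OF I ext, of v'] by (simp add: scale_def)
    \<comment> \<open>Subtraction cancels the unknown term \<open>H0 \<Psi> I\<close>.\<close>
    ultimately have "(of_real (\<Sum>i\<in>set I. v i) - of_real (\<Sum>i\<in>set I. v' i)) * \<Psi> I = (E - E') * \<Psi> I"
      by algebra
    then have "sum w (set I) = E - E'"
      using nz by (simp add: w_def sum_subtractf)
    then show "set I \<in> weight_level {1..M} w N (E - E')"
      using I multi_indices_distinct[OF I]
      by (auto simp: weight_level_def multi_indices_def distinct_card)
  qed
  \<comment> \<open>An increasing list is determined by its set, so counting subsets counts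
    multi-indices.\<close>
  moreover have "inj_on set {I \<in> multi_indices M N. c I \<noteq> 0}"
    by (auto intro!: inj_onI multi_indices_eqI)
  ultimately have "card {I \<in> multi_indices M N. c I \<noteq> 0} \<le> card (weight_level {1..M} w N (E - E'))"
    by (intro card_inj_on_le finite_weight_level) auto
  also obtain a b where "a \<in> {1..M}" "b \<in> {1..M}" "v a - v' a \<noteq> v b - v' b"
    using nc by metis
  \<comment> \<open>Injectivity of \<open>of_real\<close> turns the unequal real differences into
    unequal values of \<open>w\<close>.\<close>
  then have "card (weight_level {1..M} w N (E - E')) \<le> g M N"
    using card_weight_level_le_g[of "{1..M}" a b w N "E - E'"] by (simp add: w_def del: of_real_diff)
  finally show False using assms(6) by simp
qed

end
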